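(* Let $\varphi_1:\{0,1\}^{m_1}\to\mathcal{B}(n_1,w_1)$ be an $(m_1,n_1,w_1)$-domination mapping and $\varphi_2:\{0,1\}^{m_2}\to\mathcal{B}(n_2,w_2)$ be an $(m_2,n_2,w_2)$-domination mapping. Define $\varphi:\{0,1\}^{m_1+m_2}\to\{0,1\}^{n_1+n_2}$ by $\varphi(x_1,x_2)=(\varphi_1(x_1),\varphi_2(x_2))$ for $x_1\in\{0,1\}^{m_1}$, $x_2\in\{0,1\}^{m_2}$, where $(\cdot,\cdot)$ denotes concatenation. Then $\varphi$ is an $(m_1+m_2,n_1+n_2,w_1+w_2)$-domination mapping.
   Context: For $y \in \{0,1\}^n$, $\mathrm{wt}(y)$ is the number of nonzero coordinates, and $\mathcal{B}(n,w)=\{y\in\{0,1\}^n : \mathrm{wt}(y)\le w\}$. A domination graph is a bipartite graph $G=([m]\cup[n],E)$ with left vertex set $[m]$ and right vertex set $[n]$ having no isolated right vertices. An injective map $\varphi:\{0,1\}^m\to\mathcal{B}(n,w)$ is $G$-dominating if for every $x\in\{0,1\}^m$ and every edge $(i,j)\in E$: $x_i=0$ implies that the $j$-th coordinate of $\varphi(x)$ is $0$. An $(m,n,w)$-domination mapping is an injective map $\{0,1\}^m\to\mathcal{B}(n,w)$ that is $G$-dominating for some domination graph $G=([m]\cup[n],E)$. *)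

theory Defs
  imports Main "HOL-Library.FuncSet" "HOL-Library.Z2"
begin

text \<open>
  The points of \<open>{0,1}\<^sup>n\<close> are lists of length \<open>n\<close> over the two-element type \<^typ>\<open>bit\<close>, so that
  concatenation is \<open>@\<close>. Coordinates and vertices are numbered from \<open>0\<close>: \<open>[n]\<close> is \<open>{..<n}\<close>.
\<close>

definition cube :: "nat \<Rightarrow> bit list set" where
  "cube n = {x. length x = n}"

definition wt :: "bit list \<Rightarrow> nat" where
  "wt y = card {j. j < length y \<and> y ! j \<noteq> 0}"

definition weight_ball :: "nat \<Rightarrow> nat \<Rightarrow> bit list set" where
  "weight_ball n w = {y \<in> cube n. wt y \<le> w}"

text \<open>
  A bipartite graph with left vertex set \<open>[m]\<close> and right vertex set \<open>[n]\<close> is given by its edge set;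
  the order of the components of a pair keeps the two (disjoint) vertex classes apart.
\<close>

definition domination_graph :: "nat \<Rightarrow> nat \<Rightarrow> (nat \<times> nat) set \<Rightarrow> bool" where
  "domination_graph m n E \<longleftrightarrow>
     E \<subseteq> {..<m} \<times> {..<n} \<and> (\<forall>j\<in>{..<n}. \<exists>i\<in>{..<m}. (i, j) \<in> E)"

definition dominating :: "nat \<Rightarrow> (nat \<times> nat) set \<Rightarrow> (bit list \<Rightarrow> bit list) \<Rightarrow> bool" where
  "dominating m E \<phi> \<longleftrightarrow>
     (\<forall>x\<in>cube m. \<forall>(i, j)\<in>E. x ! i = 0 \<longrightarrow> \<phi> x ! j = 0)"

text \<open>Only the values of \<open>\<phi>\<close> on \<open>cube m\<close> matter.\<close>

definition domination_mapping :: "nat \<Rightarrow> nat \<Rightarrow> nat \<Rightarrow> (bit list \<Rightarrow> bit list) \<Rightarrow> bool" where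
  "domination_mapping m n w \<phi> \<longleftrightarrow>
     \<phi> \<in> cube m \<rightarrow> weight_ball n w \<and> inj_on \<phi> (cube m) \<and>
     (\<exists>E. domination_graph m n E \<and> dominating m E \<phi>)"

end

theory Submission
  imports Defs
begin

text \<open>Concatenation lets the two maps act on separate blocks of coordinates. Weights of blocks
  add (\<open>wt_append\<close>), so the images land in the larger ball
  (\<open>weight_ball_append\<close>). Every input splits into its two blocks
  (\<open>cube_add_cases\<close>), and since the images under \<open>\<phi>1\<close> all have length
  \<open>n1\<close>, the image of the whole determines the images of both blocks, which gives
  injectivity. The witnessing graph is the disjoint union of the two given graphs: each of its edges
  lies within one block, where domination is inherited from \<open>\<phi>1\<close> or
  \<open>\<phi>2\<close>.\<close>

lemma wt_eq_length_filter: "wt y = length (filter (\<lambda>b. b \<noteq> 0) y)"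
  by (simp add: wt_def length_filter_conv_card)

text \<open>Counting with \<open>filter\<close> instead of a set of indices avoids shifting the
  indices of the second block.\<close>

lemma wt_append: "wt (x @ y) = wt x + wt y"
  by (simp add: wt_eq_length_filter)

lemma cube_add_cases:
  assumes "x \<in> cube (m1 + m2)"
  obtains x1 x2 where "x = x1 @ x2" "x1 \<in> cube m1" "x2 \<in> cube m2"
proof
  show "x = take m1 x @ drop m1 x" by simp
  show "take m1 x \<in> cube m1" "drop m1 x \<in> cube m2"
    using assms by (auto simp: cube_def)
qed

lemma weight_ball_append:
  assumes "y1 \<in> weight_ball n1 w1" "y2 \<in> weight_ball n2 w2"
  shows "y1 @ y2 \<in> weight_ball (n1 + n2) (w1 + w2)"
  using assms by (auto simp: weight_ball_def cube_def wt_append)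

text \<open>When \<open>E1\<close> lies in \<open>{..<m} \<times> {..<n}\<close>, this is the
  disjoint union of the graphs; the shifts are the offsets at which the second blocks of input and
  output start.\<close>

definition shifted_union ::
    "nat \<Rightarrow> nat \<Rightarrow> (nat \<times> nat) set \<Rightarrow> (nat \<times> nat) set \<Rightarrow> (nat \<times> nat) set" where
  "shifted_union m n E1 E2 = E1 \<union> (\<lambda>(i, j). (m + i, n + j)) ` E2"

lemma domination_graph_shifted_union:
  assumes "domination_graph m1 n1 E1" "domination_graph m2 n2 E2"
  shows "domination_graph (m1 + m2) (n1 + n2) (shifted_union m1 n1 E1 E2)"
  unfolding domination_graph_def
proof (intro conjI ballI)
  show "shifted_union m1 n1 E1 E2 \<subseteq> {..<m1 + m2} \<times> {..<n1 + n2}"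
    using assms by (fastforce simp: domination_graph_def shifted_union_def)
next
  fix j assume j: "j \<in> {..<n1 + n2}"
  show "\<exists>i\<in>{..<m1 + m2}. (i, j) \<in> shifted_union m1 n1 E1 E2"
  proof (cases "j < n1")
    case True
    then obtain i where "i < m1" "(i, j) \<in> E1"
      using assms(1) by (auto simp: domination_graph_def)
    then show ?thesis
      by (intro bexI[of _ i]) (auto simp: shifted_union_def)
  next
    case False
    with j have "j - n1 < n2" by auto
    then obtain i where "i < m2" "(i, j - n1) \<in> E2"
      using assms(2) by (auto simp: domination_graph_def)
    \<comment> \<open>A right vertex beyond the first block is the copy of \<open>j - n1\<close>, so
      the copy of a neighbour of \<open>j - n1\<close> serves.\<close>
    with False show ?thesis
      by (intro bexI[of _ "m1 + i"]) (auto simp: shifted_union_def image_iff intro!: bexI[of _ "(i, j - n1)"])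
  qed
qed

theorem theorem9:
  fixes m1 n1 w1 m2 n2 w2 :: nat
    and \<phi>1 \<phi>2 \<phi> :: "bit list \<Rightarrow> bit list"
  assumes "domination_mapping m1 n1 w1 \<phi>1"
    and "domination_mapping m2 n2 w2 \<phi>2"
    and "\<And>x1 x2. x1 \<in> cube m1 \<Longrightarrow> x2 \<in> cube m2 \<Longrightarrow> \<phi> (x1 @ x2) = \<phi>1 x1 @ \<phi>2 x2"
  shows "domination_mapping (m1 + m2) (n1 + n2) (w1 + w2) \<phi>"
proof -
  note \<phi>_append = assms(3)
  have ball1: "\<phi>1 x \<in> weight_ball n1 w1" if "x \<in> cube m1" for x
    using assms(1) that by (auto simp: domination_mapping_def)
  have ball2: "\<phi>2 x \<in> weight_ball n2 w2" if "x \<in> cube m2" for x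
    using assms(2) that by (auto simp: domination_mapping_def)
  have len1: "length (\<phi>1 x) = n1" if "x \<in> cube m1" for x
    using ball1[OF that] by (simp add: weight_ball_def cube_def)
  have inj1: "inj_on \<phi>1 (cube m1)" and inj2: "inj_on \<phi>2 (cube m2)"
    using assms(1,2) by (auto simp: domination_mapping_def)
  obtain E1 where graph1: "domination_graph m1 n1 E1" and dom1: "dominating m1 E1 \<phi>1"
    using assms(1) by (auto simp: domination_mapping_def)
  obtain E2 where graph2: "domination_graph m2 n2 E2" and dom2: "dominating m2 E2 \<phi>2"
    using assms(2) by (auto simp: domination_mapping_def)
  have "\<phi> \<in> cube (m1 + m2) \<rightarrow> weight_ball (n1 + n2) (w1 + w2)"
    by (auto elim!: cube_add_cases simp: \<phi>_append ball1 ball2 weight_ball_append)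
  moreover have "inj_on \<phi> (cube (m1 + m2))"
  proof (rule inj_onI)
    fix x y
    assume "x \<in> cube (m1 + m2)" "y \<in> cube (m1 + m2)" and eq: "\<phi> x = \<phi> y"
    then obtain x1 x2 y1 y2 where xy: "x = x1 @ x2" "y = y1 @ y2"
      and mem: "x1 \<in> cube m1" "x2 \<in> cube m2" "y1 \<in> cube m1" "y2 \<in> cube m2"
      by (metis cube_add_cases)
    \<comment> \<open>Both first parts have length \<open>n1\<close>, so equal concatenations agree
      part by part.\<close>
    with eq have "\<phi>1 x1 = \<phi>1 y1" "\<phi>2 x2 = \<phi>2 y2"
      by (auto simp: \<phi>_append len1)
    with mem show "x = y"
      unfolding xy using inj1 inj2 by (auto dest: inj_onD)
  qed
  moreover have "dominating (m1 + m2) (shifted_union m1 n1 E1 E2) \<phi>"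
    unfolding dominating_def
  proof (intro ballI, clarify)
    fix x i j
    assume "x \<in> cube (m1 + m2)" and edge: "(i, j) \<in> shifted_union m1 n1 E1 E2"
      and zero: "x ! i = 0"
    then obtain x1 x2 where x: "x = x1 @ x2" and mem: "x1 \<in> cube m1" "x2 \<in> cube m2"
      by (metis cube_add_cases)
    have len: "length x1 = m1"
      using mem by (simp add: cube_def)
    from edge consider "(i, j) \<in> E1"
      | i' j' where "i = m1 + i'" "j = n1 + j'" "(i', j') \<in> E2"
      by (auto simp: shifted_union_def)
    then show "\<phi> x ! j = 0"
    proof cases
      case 1
      \<comment> \<open>These bounds make \<open>nth_append\<close> read both coordinates in the
        first blocks.\<close>
      then have "i < m1" "j < n1"
        using graph1 by (auto simp: domination_graph_def)
      with 1 zero show ?thesis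
        using dom1 mem by (auto simp: x \<phi>_append nth_append len len1 dominating_def)
    next
      case 2
      \<comment> \<open>The lengths \<open>m1\<close> and \<open>n1\<close> of the first blocks
        cancel the shifts, leaving coordinate \<open>i'\<close> of \<open>x2\<close> and coordinate
        \<open>j'\<close> of \<open>\<phi>2 x2\<close>.\<close>
      with zero show ?thesis
        using dom2 mem by (auto simp: x \<phi>_append nth_append len len1 dominating_def)
    qed
  qed
  ultimately show ?thesis
    unfolding domination_mapping_def
    using domination_graph_shifted_union[OF graph1 graph2] by blast
qed

end
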